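(* (Confluence) If $M$, $N$ and $N'$ are terms such that $M \twoheadrightarrow N$ and $M \twoheadrightarrow N'$, then there exists a term $P$ such that $N \twoheadrightarrow P$ and $N' \twoheadrightarrow P$.
   Context: Terms. Fix a countable set $\mathcal{E}$ of exception names and a set of term variables. Terms, taken up to $\alpha$-equivalence, are generated by $$M,N ::= x \mid \lambda x.M \mid M\,N \mid \mathtt{raise}\,\varepsilon \mid \mathtt{try}\ M\ \mathtt{with}\ \varepsilon\mapsto N \mid 0 \mid S \mid \mathtt{rec} \mid \mathtt{nil} \mid \mathtt{cons} \mid \mathtt{fold}$$ with $\varepsilon\in\mathcal{E}$; application associates to the left, and $\mathtt{try}$ does not bind $\varepsilon$. Regular values are the closed terms of one of the forms $\lambda x.M$, $0$, $S$, $S\,N$, $\mathtt{rec}$, $\mathtt{rec}\,M$, $\mathtt{rec}\,M\,N$, $\mathtt{nil}$, $\mathtt{cons}$, $\mathtt{cons}\,M$, $\mathtt{cons}\,M\,N$, $\mathtt{fold}$, $\mathtt{fold}\,M$, $\mathtt{fold}\,M\,N$ (with $M,N$ arbitrary terms). Reduction. The base rules are: (1) $(\lambda x.M)\,N \to M[x:=N]$; (2) $(\mathtt{raise}\,\varepsilon)\,M \to \mathtt{raise}\,\varepsilon$; (3) $\mathtt{try}\ (\mathtt{raise}\,\varepsilon)\ \mathtt{with}\ \varepsilon\mapsto N \to N$; (4) $\mathtt{try}\ (\mathtt{raise}\,\varepsilon')\ \mathtt{with}\ \varepsilon\mapsto N \to \mathtt{raise}\,\varepsilon'$ if $\varepsilon\neq\varepsilon'$;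 (5) $\mathtt{try}\ V\ \mathtt{with}\ \varepsilon\mapsto N \to V$ if $V$ is a regular value; (6) $\mathtt{rec}\,X\,Y\,0 \to X$; $\mathtt{rec}\,X\,Y\,(S\,N)\to Y\,N\,(\mathtt{rec}\,X\,Y\,N)$; $\mathtt{rec}\,X\,Y\,(\mathtt{raise}\,\varepsilon)\to\mathtt{raise}\,\varepsilon$; (7) $\mathtt{fold}\,X\,Y\,\mathtt{nil}\to X$; $\mathtt{fold}\,X\,Y\,(\mathtt{cons}\,E\,L)\to Y\,E\,L\,(\mathtt{fold}\,X\,Y\,L)$; $\mathtt{fold}\,X\,Y\,(\mathtt{raise}\,\varepsilon)\to\mathtt{raise}\,\varepsilon$. The reduction $\to$ is the closure of these rules under all term constructors (under $\lambda$, on both sides of an application, in the body and in the handler of $\mathtt{try}$), and $\twoheadrightarrow$ is the reflexive transitive closure of $\to$. *)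

theory Defs
  imports "HOL-Library.Countable"
begin

text \<open>
  Terms up to alpha-equivalence are represented with de Bruijn indices: a variable
  \<open>Var i\<close> standing under \<open>k\<close> abstractions is bound if \<open>i < k\<close>, and otherwise denotes
  the free variable number \<open>i - k\<close>. The type parameter is the set of exception names.
\<close>

datatype 'e trm =
    Var nat
  | Lam "'e trm"
  | App "'e trm" "'e trm" (infixl "\<bullet>" 200)
  | Raise 'e
  | Try "'e trm" 'e "'e trm"  \<comment> \<open>\<open>Try M e N\<close> is try \<open>M\<close> with \<open>e \<mapsto> N\<close>; it binds nothing\<close>
  | Zero
  | Succ
  | Rec
  | NilT
  | ConsT
  | FoldT

primrec lift :: "'e trm \<Rightarrow> nat \<Rightarrow> 'e trm" where
  "lift (Var i) k = (if i < k then Var i else Var (Suc i))"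
| "lift (Lam M) k = Lam (lift M (Suc k))"
| "lift (M \<bullet> N) k = lift M k \<bullet> lift N k"
| "lift (Raise e) k = Raise e"
| "lift (Try M e N) k = Try (lift M k) e (lift N k)"
| "lift Zero k = Zero"
| "lift Succ k = Succ"
| "lift Rec k = Rec"
| "lift NilT k = NilT"
| "lift ConsT k = ConsT"
| "lift FoldT k = FoldT"

text \<open>
  \<open>subst M k N\<close> replaces index \<open>k\<close> in \<open>M\<close> by \<open>N\<close> and lowers the indices above \<open>k\<close>,
  since the abstraction that bound \<open>k\<close> disappears.
\<close>

primrec subst :: "'e trm \<Rightarrow> nat \<Rightarrow> 'e trm \<Rightarrow> 'e trm" where
  "subst (Var i) k N = (if k < i then Var (i - 1) else if i = k then N else Var i)"
| "subst (Lam M) k N = Lam (subst M (Suc k) (lift N 0))"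
| "subst (M \<bullet> M') k N = subst M k N \<bullet> subst M' k N"
| "subst (Raise e) k N = Raise e"
| "subst (Try M e M') k N = Try (subst M k N) e (subst M' k N)"
| "subst Zero k N = Zero"
| "subst Succ k N = Succ"
| "subst Rec k N = Rec"
| "subst NilT k N = NilT"
| "subst ConsT k N = ConsT"
| "subst FoldT k N = FoldT"

primrec free_vars :: "'e trm \<Rightarrow> nat set" where
  "free_vars (Var i) = {i}"
| "free_vars (Lam M) = {i. Suc i \<in> free_vars M}"
| "free_vars (M \<bullet> N) = free_vars M \<union> free_vars N"
| "free_vars (Raise e) = {}"
| "free_vars (Try M e N) = free_vars M \<union> free_vars N"
| "free_vars Zero = {}"
| "free_vars Succ = {}"
| "free_vars Rec = {}"
| "free_vars NilT = {}"
| "free_vars ConsT = {}"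
| "free_vars FoldT = {}"

definition closed_trm :: "'e trm \<Rightarrow> bool" where
  "closed_trm M \<longleftrightarrow> free_vars M = {}"

definition regular_value :: "'e trm \<Rightarrow> bool" where
  "regular_value V \<longleftrightarrow> closed_trm V \<and>
    ((\<exists>M. V = Lam M) \<or>
     V = Zero \<or>
     V = Succ \<or> (\<exists>N. V = Succ \<bullet> N) \<or>
     V = Rec \<or> (\<exists>M. V = Rec \<bullet> M) \<or> (\<exists>M N. V = Rec \<bullet> M \<bullet> N) \<or>
     V = NilT \<or>
     V = ConsT \<or> (\<exists>M. V = ConsT \<bullet> M) \<or> (\<exists>M N. V = ConsT \<bullet> M \<bullet> N) \<or>
     V = FoldT \<or> (\<exists>M. V = FoldT \<bullet> M) \<or> (\<exists>M N. V = FoldT \<bullet> M \<bullet> N))"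

inductive red :: "'e trm \<Rightarrow> 'e trm \<Rightarrow> bool" (infix "\<rightarrow>\<^sub>r" 50) where
  beta: "Lam M \<bullet> N \<rightarrow>\<^sub>r subst M 0 N"
| raise_app: "Raise e \<bullet> M \<rightarrow>\<^sub>r Raise e"
| try_catch: "Try (Raise e) e N \<rightarrow>\<^sub>r N"
| try_pass: "e \<noteq> e' \<Longrightarrow> Try (Raise e') e N \<rightarrow>\<^sub>r Raise e'"
| try_value: "regular_value V \<Longrightarrow> Try V e N \<rightarrow>\<^sub>r V"
| rec_zero: "Rec \<bullet> X \<bullet> Y \<bullet> Zero \<rightarrow>\<^sub>r X"
| rec_succ: "Rec \<bullet> X \<bullet> Y \<bullet> (Succ \<bullet> N) \<rightarrow>\<^sub>r Y \<bullet> N \<bullet> (Rec \<bullet> X \<bullet> Y \<bullet> N)"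
| rec_raise: "Rec \<bullet> X \<bullet> Y \<bullet> Raise e \<rightarrow>\<^sub>r Raise e"
| fold_nil: "FoldT \<bullet> X \<bullet> Y \<bullet> NilT \<rightarrow>\<^sub>r X"
| fold_cons: "FoldT \<bullet> X \<bullet> Y \<bullet> (ConsT \<bullet> E \<bullet> L) \<rightarrow>\<^sub>r Y \<bullet> E \<bullet> L \<bullet> (FoldT \<bullet> X \<bullet> Y \<bullet> L)"
| fold_raise: "FoldT \<bullet> X \<bullet> Y \<bullet> Raise e \<rightarrow>\<^sub>r Raise e"
| lam: "M \<rightarrow>\<^sub>r M' \<Longrightarrow> Lam M \<rightarrow>\<^sub>r Lam M'"
| app_left: "M \<rightarrow>\<^sub>r M' \<Longrightarrow> M \<bullet> N \<rightarrow>\<^sub>r M' \<bullet> N"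
| app_right: "N \<rightarrow>\<^sub>r N' \<Longrightarrow> M \<bullet> N \<rightarrow>\<^sub>r M \<bullet> N'"
| try_body: "M \<rightarrow>\<^sub>r M' \<Longrightarrow> Try M e N \<rightarrow>\<^sub>r Try M' e N"
| try_handler: "N \<rightarrow>\<^sub>r N' \<Longrightarrow> Try M e N \<rightarrow>\<^sub>r Try M e N'"

abbreviation reds :: "'e trm \<Rightarrow> 'e trm \<Rightarrow> bool" (infix "\<rightarrow>\<^sub>r\<^sup>*" 50) where
  "M \<rightarrow>\<^sub>r\<^sup>* N \<equiv> red\<^sup>*\<^sup>* M N"

end

theory Submission
  imports Defs "HOL-Library.Confluence"
begin

text \<open>
  The rules are left-linear and do not overlap, and the side condition of rule (5) is stable
  under reduction and substitution: a regular value is closed, and none of its reducts changes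
  its head. So Takahashi's method applies. Parallel reduction contracts any set of redexes
  present in a term, and every term \<open>M\<close> has a complete development, a parallel reduct to which
  all parallel reducts of \<open>M\<close> reduce in one parallel step. This gives the diamond property of
  parallel reduction, whose reflexive transitive closure is that of reduction.
\<close>

section \<open>Lifting and substitution\<close>

lemma lift_lift: "i < Suc k \<Longrightarrow> lift (lift M i) (Suc k) = lift (lift M k) i"
  by (induction M arbitrary: i k) auto

text \<open>Two commutation laws are needed. Here lifting acts at or above the substituted index, as
  for a beta contractum (\<open>j = 0\<close>); in \<open>lift_subst_lt\<close> it acts at or below,
  as when substitution passes under \<open>Lam\<close> (\<open>i = 0\<close>).\<close>

lemma lift_subst: "j < Suc i \<Longrightarrow> lift (subst M j N) i = subst (lift M (Suc i)) j (lift N i)"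
  by (induction M arbitrary: i j N) (auto simp: lift_lift)

lemma lift_subst_lt: "i < Suc j \<Longrightarrow> lift (subst M j N) i = subst (lift M i) (Suc j) (lift N i)"
  by (induction M arbitrary: i j N) (auto simp: lift_lift)

lemma subst_lift [simp]: "subst (lift M k) k N = M"
  by (induction M arbitrary: k N) auto

text \<open>De Bruijn form of the substitution lemma M[y:=K][x:=N[y:=K]] = M[x:=N][y:=K] for x not
  free in K, which \<open>lift K i\<close> ensures. Index \<open>Suc j\<close> becomes
  \<open>j\<close> once \<open>i\<close> is eliminated.\<close>

lemma subst_subst:
  "i < Suc j \<Longrightarrow>
    subst (subst M (Suc j) (lift K i)) i (subst N j K) = subst (subst M i N) j K"
  by (induction M arbitrary: i j N K)
    (auto simp: lift_lift [symmetric] lift_subst_lt)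

text \<open>The body of a closed abstraction need not be closed, but an index bound passes to the
  body, raised by one. Inductions therefore use bounds, with closedness as the case
  \<open>n = 0\<close>.\<close>

lemma free_vars_Lam_bound: "free_vars (Lam M) \<subseteq> {..<n} \<longleftrightarrow> free_vars M \<subseteq> {..<Suc n}"
proof
  assume L: "free_vars (Lam M) \<subseteq> {..<n}"
  show "free_vars M \<subseteq> {..<Suc n}"
  proof
    fix i assume "i \<in> free_vars M"
    with L show "i \<in> {..<Suc n}" by (cases i) auto
  qed
qed auto

lemma lift_fresh: "free_vars M \<subseteq> {..<k} \<Longrightarrow> lift M k = M"
proof (induction M arbitrary: k)
  case (Lam M)
  then show ?case unfolding free_vars_Lam_bound by simp
qed auto

lemma subst_fresh: "free_vars M \<subseteq> {..<k} \<Longrightarrow> subst M k N = M"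
proof (induction M arbitrary: k N)
  case (Lam M)
  then show ?case unfolding free_vars_Lam_bound by simp
qed auto

lemma free_vars_lift: "free_vars M \<subseteq> {..<n} \<Longrightarrow> free_vars (lift M k) \<subseteq> {..<Suc n}"
proof (induction M arbitrary: n k)
  case (Lam M)
  then show ?case
    unfolding lift.simps free_vars_Lam_bound by blast
qed auto

text \<open>Indices above \<open>k\<close> drop by one, and those below \<open>k\<close> are already
  less than \<open>n\<close> because \<open>k \<le> n\<close>.\<close>

lemma free_vars_subst:
  "free_vars M \<subseteq> {..<Suc n} \<Longrightarrow> free_vars N \<subseteq> {..<n} \<Longrightarrow> k \<le> n \<Longrightarrow>
    free_vars (subst M k N) \<subseteq> {..<n}"
proof (induction M arbitrary: n k N)
  case (Lam M)
  then show ?case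
    unfolding subst.simps free_vars_Lam_bound by (meson Suc_le_mono free_vars_lift)
qed auto

section \<open>Parallel reduction\<close>

text \<open>Subterms that a contraction discards carry no premise, and a copied subterm has one
  common reduct in all copies. The redex rules coexist with \<open>App\<close> and
  \<open>Try\<close>, so each redex may be contracted or kept.\<close>

inductive par :: "'e trm \<Rightarrow> 'e trm \<Rightarrow> bool" (infix "\<Rightarrow>\<^sub>p" 50) where
  Var: "Var i \<Rightarrow>\<^sub>p Var i"
| Lam: "M \<Rightarrow>\<^sub>p M' \<Longrightarrow> Lam M \<Rightarrow>\<^sub>p Lam M'"
| App: "M \<Rightarrow>\<^sub>p M' \<Longrightarrow> N \<Rightarrow>\<^sub>p N' \<Longrightarrow> M \<bullet> N \<Rightarrow>\<^sub>p M' \<bullet> N'"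
| Raise: "Raise e \<Rightarrow>\<^sub>p Raise e"
| Try: "M \<Rightarrow>\<^sub>p M' \<Longrightarrow> N \<Rightarrow>\<^sub>p N' \<Longrightarrow> Try M e N \<Rightarrow>\<^sub>p Try M' e N'"
| Zero: "Zero \<Rightarrow>\<^sub>p Zero"
| Succ: "Succ \<Rightarrow>\<^sub>p Succ"
| Rec: "Rec \<Rightarrow>\<^sub>p Rec"
| NilT: "NilT \<Rightarrow>\<^sub>p NilT"
| ConsT: "ConsT \<Rightarrow>\<^sub>p ConsT"
| FoldT: "FoldT \<Rightarrow>\<^sub>p FoldT"
| beta: "M \<Rightarrow>\<^sub>p M' \<Longrightarrow> N \<Rightarrow>\<^sub>p N' \<Longrightarrow> Lam M \<bullet> N \<Rightarrow>\<^sub>p subst M' 0 N'"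
| raise_app: "Raise e \<bullet> M \<Rightarrow>\<^sub>p Raise e"
| try_catch: "N \<Rightarrow>\<^sub>p N' \<Longrightarrow> Try (Raise e) e N \<Rightarrow>\<^sub>p N'"
| try_pass: "e \<noteq> e' \<Longrightarrow> Try (Raise e') e N \<Rightarrow>\<^sub>p Raise e'"
| try_value: "regular_value V \<Longrightarrow> V \<Rightarrow>\<^sub>p V' \<Longrightarrow> Try V e N \<Rightarrow>\<^sub>p V'"
| rec_zero: "X \<Rightarrow>\<^sub>p X' \<Longrightarrow> Rec \<bullet> X \<bullet> Y \<bullet> Zero \<Rightarrow>\<^sub>p X'"
| rec_succ: "X \<Rightarrow>\<^sub>p X' \<Longrightarrow> Y \<Rightarrow>\<^sub>p Y' \<Longrightarrow> N \<Rightarrow>\<^sub>p N' \<Longrightarrow>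
    Rec \<bullet> X \<bullet> Y \<bullet> (Succ \<bullet> N) \<Rightarrow>\<^sub>p Y' \<bullet> N' \<bullet> (Rec \<bullet> X' \<bullet> Y' \<bullet> N')"
| rec_raise: "Rec \<bullet> X \<bullet> Y \<bullet> Raise e \<Rightarrow>\<^sub>p Raise e"
| fold_nil: "X \<Rightarrow>\<^sub>p X' \<Longrightarrow> FoldT \<bullet> X \<bullet> Y \<bullet> NilT \<Rightarrow>\<^sub>p X'"
| fold_cons: "X \<Rightarrow>\<^sub>p X' \<Longrightarrow> Y \<Rightarrow>\<^sub>p Y' \<Longrightarrow> E \<Rightarrow>\<^sub>p E' \<Longrightarrow> L \<Rightarrow>\<^sub>p L' \<Longrightarrow>
    FoldT \<bullet> X \<bullet> Y \<bullet> (ConsT \<bullet> E \<bullet> L) \<Rightarrow>\<^sub>p Y' \<bullet> E' \<bullet> L' \<bullet> (FoldT \<bullet> X' \<bullet> Y' \<bullet> L')"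
| fold_raise: "FoldT \<bullet> X \<bullet> Y \<bullet> Raise e \<Rightarrow>\<^sub>p Raise e"

text \<open>These shapes are not redexes at the root, so inversion keeps the head and is safe as
  \<open>elim!\<close>. General applications and \<open>Try\<close> may be redexes and are inverted
  only on demand.\<close>

inductive_cases par_VarE [elim!]: "Var i \<Rightarrow>\<^sub>p P"
inductive_cases par_LamE [elim!]: "Lam M \<Rightarrow>\<^sub>p P"
inductive_cases par_RaiseE [elim!]: "Raise e \<Rightarrow>\<^sub>p P"
inductive_cases par_ZeroE [elim!]: "Zero \<Rightarrow>\<^sub>p P"
inductive_cases par_SuccE [elim!]: "Succ \<Rightarrow>\<^sub>p P"
inductive_cases par_Succ1E [elim!]: "Succ \<bullet> M \<Rightarrow>\<^sub>p P"
inductive_cases par_RecE [elim!]: "Rec \<Rightarrow>\<^sub>p P"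
inductive_cases par_Rec1E [elim!]: "Rec \<bullet> M \<Rightarrow>\<^sub>p P"
inductive_cases par_Rec2E [elim!]: "Rec \<bullet> M \<bullet> N \<Rightarrow>\<^sub>p P"
inductive_cases par_NilTE [elim!]: "NilT \<Rightarrow>\<^sub>p P"
inductive_cases par_ConsTE [elim!]: "ConsT \<Rightarrow>\<^sub>p P"
inductive_cases par_ConsT1E [elim!]: "ConsT \<bullet> M \<Rightarrow>\<^sub>p P"
inductive_cases par_ConsT2E [elim!]: "ConsT \<bullet> M \<bullet> N \<Rightarrow>\<^sub>p P"
inductive_cases par_FoldTE [elim!]: "FoldT \<Rightarrow>\<^sub>p P"
inductive_cases par_FoldT1E [elim!]: "FoldT \<bullet> M \<Rightarrow>\<^sub>p P"
inductive_cases par_FoldT2E [elim!]: "FoldT \<bullet> M \<bullet> N \<Rightarrow>\<^sub>p P"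
inductive_cases par_AppE: "M \<bullet> N \<Rightarrow>\<^sub>p P"
inductive_cases par_TryE: "Try M e N \<Rightarrow>\<^sub>p P"

lemma par_refl [simp]: "M \<Rightarrow>\<^sub>p M"
  by (induction M) (auto intro: par.intros)

lemma free_vars_par: "M \<Rightarrow>\<^sub>p M' \<Longrightarrow> free_vars M \<subseteq> {..<n} \<Longrightarrow> free_vars M' \<subseteq> {..<n}"
proof (induction arbitrary: n rule: par.induct)
  case (Lam M M')
  then show ?case unfolding free_vars_Lam_bound by blast
next
  case (beta M M' N N')
  have "free_vars (Lam M) \<subseteq> {..<n}" "free_vars N \<subseteq> {..<n}"
    using beta.prems by auto
  then show ?case
    unfolding free_vars_Lam_bound by (intro free_vars_subst beta.IH) auto
qed auto

lemma regular_value_lift: "regular_value V \<Longrightarrow> lift V k = V"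
  by (rule lift_fresh) (auto simp: regular_value_def closed_trm_def)

lemma regular_value_subst: "regular_value V \<Longrightarrow> subst V k N = V"
  by (rule subst_fresh) (auto simp: regular_value_def closed_trm_def)

text \<open>A regular value has too few arguments to be a redex itself, so its head survives;
  closedness survives by \<open>free_vars_par\<close> at \<open>n = 0\<close>. This resolves the
  overlap of \<open>try_value\<close> with reductions inside the body.\<close>

lemma regular_value_par:
  assumes "regular_value V" and "V \<Rightarrow>\<^sub>p V'"
  shows "regular_value V'"
proof -
  have "closed_trm V'"
    using free_vars_par [OF assms(2), of 0] assms(1)
    by (auto simp: regular_value_def closed_trm_def)
  with assms show ?thesis
    unfolding regular_value_def by (elim conjE disjE exE) auto
qed

text \<open>Keeps \<open>try_value\<close> from overlapping with \<open>try_catch\<close> and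
  \<open>try_pass\<close>.\<close>

lemma not_regular_value_Raise [simp]: "\<not> regular_value (Raise e)"
  by (simp add: regular_value_def)

lemma par_lift: "M \<Rightarrow>\<^sub>p M' \<Longrightarrow> lift M k \<Rightarrow>\<^sub>p lift M' k"
proof (induction arbitrary: k rule: par.induct)
  case (beta M M' N N')
  then show ?case by (simp add: lift_subst par.beta)
next
  case (try_value V V' e N)
  then show ?case by (simp add: regular_value_lift par.try_value)
qed (auto intro: par.intros)

lemma par_subst: "M \<Rightarrow>\<^sub>p M' \<Longrightarrow> N \<Rightarrow>\<^sub>p N' \<Longrightarrow> subst M k N \<Rightarrow>\<^sub>p subst M' k N'"
proof (induction arbitrary: k N N' rule: par.induct)
  case (Lam M M')
  then show ?case by (simp add: par.Lam par_lift)
next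
  case (beta M M' K K')
  \<comment> \<open>Read from right to left at \<open>i = 0\<close>, \<open>subst_subst\<close>
    exhibits the substituted contractum as the contractum of the substituted redex.\<close>
  then show ?case
    by (simp add: subst_subst [symmetric] par.beta par_lift)
next
  \<comment> \<open>Being closed, \<open>V\<close> is fixed by the substitution and so still
    satisfies the side condition.\<close>
  case (try_value V V' e K)
  then show ?case by (simp add: regular_value_subst par.try_value)
qed (auto intro: par.intros)

section \<open>Complete developments\<close>

text \<open>Takahashi's triangle property serves as the specification, instead of a recursive
  function on overlapping patterns. Taking \<open>P = M\<close> shows that \<open>D\<close> is
  itself a parallel reduct of \<open>M\<close>.\<close>

definition complete_development :: "'e trm \<Rightarrow> 'e trm \<Rightarrow> bool" where
  "complete_development M D \<longleftrightarrow> (\<forall>P. M \<Rightarrow>\<^sub>p P \<longrightarrow> P \<Rightarrow>\<^sub>p D)"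

lemma complete_developmentI: "(\<And>P. M \<Rightarrow>\<^sub>p P \<Longrightarrow> P \<Rightarrow>\<^sub>p D) \<Longrightarrow> complete_development M D"
  by (simp add: complete_development_def)

lemma complete_developmentD: "complete_development M D \<Longrightarrow> M \<Rightarrow>\<^sub>p P \<Longrightarrow> P \<Rightarrow>\<^sub>p D"
  by (simp add: complete_development_def)

lemma complete_development_App:
  fixes M N :: "'e trm"
  assumes IH: "\<And>K :: 'e trm. size K < size (M \<bullet> N) \<Longrightarrow> \<exists>D. complete_development K D"
  shows "\<exists>D. complete_development (M \<bullet> N) D"
proof -
  \<comment> \<open>The last case speaks of reducts rather than shapes: if some parallel reduct is
    not componentwise, inverting its derivation exhibits one of the eight redexes.\<close>
  consider
      (beta) K where "M = Lam K"
    | (raise_app) e where "M = Raise e"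
    | (rec_zero) X Y where "M = Rec \<bullet> X \<bullet> Y" "N = Zero"
    | (rec_succ) X Y K where "M = Rec \<bullet> X \<bullet> Y" "N = Succ \<bullet> K"
    | (rec_raise) X Y e where "M = Rec \<bullet> X \<bullet> Y" "N = Raise e"
    | (fold_nil) X Y where "M = FoldT \<bullet> X \<bullet> Y" "N = NilT"
    | (fold_cons) X Y E L where "M = FoldT \<bullet> X \<bullet> Y" "N = ConsT \<bullet> E \<bullet> L"
    | (fold_raise) X Y e where "M = FoldT \<bullet> X \<bullet> Y" "N = Raise e"
    | (no_redex) "\<And>P. M \<bullet> N \<Rightarrow>\<^sub>p P \<Longrightarrow> \<exists>M' N'. P = M' \<bullet> N' \<and> M \<Rightarrow>\<^sub>p M' \<and> N \<Rightarrow>\<^sub>p N'"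
  proof (cases "\<exists>P. M \<bullet> N \<Rightarrow>\<^sub>p P \<and> \<not> (\<exists>M' N'. P = M' \<bullet> N' \<and> M \<Rightarrow>\<^sub>p M' \<and> N \<Rightarrow>\<^sub>p N')")
    case True
    then obtain P where P: "M \<bullet> N \<Rightarrow>\<^sub>p P"
      "\<not> (\<exists>M' N'. P = M' \<bullet> N' \<and> M \<Rightarrow>\<^sub>p M' \<and> N \<Rightarrow>\<^sub>p N')"
      by blast
    from P(1) show thesis by cases (use P(2) that(1-8) in blast)+
  next
    case False
    then show thesis using that(9) by blast
  qed
  then show ?thesis
  proof cases
    case beta
    obtain A B where D: "complete_development K A" "complete_development N B"
      using IH [of K] IH [of N] beta by auto
    \<comment> \<open>A reduct that keeps the redex reaches the development by
      \<open>par.beta\<close>; one that contracts it does so by \<open>par_subst\<close>.\<close>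
    have "complete_development (M \<bullet> N) (subst A 0 B)"
      unfolding beta
      by (rule complete_developmentI, erule par_AppE)
        (auto intro: par.beta par_subst complete_developmentD [OF D(1)] complete_developmentD [OF D(2)])
    then show ?thesis ..
  next
    case raise_app
    have "complete_development (M \<bullet> N) (Raise e)"
      unfolding raise_app
      by (rule complete_developmentI, erule par_AppE) (auto intro: par.intros)
    then show ?thesis ..
  next
    case rec_zero
    obtain A where D: "complete_development X A"
      using IH [of X] rec_zero by auto
    have "complete_development (M \<bullet> N) A"
      unfolding rec_zero
      by (rule complete_developmentI, erule par_AppE)
        (auto intro: par.rec_zero complete_developmentD [OF D])
    then show ?thesis ..
  next
    case rec_succ
    obtain A B C where D: "complete_development X A" "complete_development Y B"
        "complete_development K C"
      using IH [of X] IH [of Y] IH [of K] rec_succ by auto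
    note D = D [THEN complete_developmentD]
    have "complete_development (M \<bullet> N) (B \<bullet> C \<bullet> (Rec \<bullet> A \<bullet> B \<bullet> C))"
      unfolding rec_succ
      by (rule complete_developmentI, erule par_AppE) (auto simp: par.rec_succ par.App D)
    then show ?thesis ..
  next
    case rec_raise
    have "complete_development (M \<bullet> N) (Raise e)"
      unfolding rec_raise
      by (rule complete_developmentI, erule par_AppE) (auto intro: par.intros)
    then show ?thesis ..
  next
    case fold_nil
    obtain A where D: "complete_development X A"
      using IH [of X] fold_nil by auto
    have "complete_development (M \<bullet> N) A"
      unfolding fold_nil
      by (rule complete_developmentI, erule par_AppE)
        (auto intro: par.fold_nil complete_developmentD [OF D])
    then show ?thesis ..
  next
    case fold_cons
    obtain A B C F where D: "complete_development X A" "complete_development Y B"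
        "complete_development E C" "complete_development L F"
      using IH [of X] IH [of Y] IH [of E] IH [of L] fold_cons by auto
    note D = D [THEN complete_developmentD]
    have "complete_development (M \<bullet> N) (B \<bullet> C \<bullet> F \<bullet> (FoldT \<bullet> A \<bullet> B \<bullet> F))"
      unfolding fold_cons
      by (rule complete_developmentI, erule par_AppE) (auto simp: par.fold_cons par.App D)
    then show ?thesis ..
  next
    case fold_raise
    have "complete_development (M \<bullet> N) (Raise e)"
      unfolding fold_raise
      by (rule complete_developmentI, erule par_AppE) (auto intro: par.intros)
    then show ?thesis ..
  next
    case no_redex
    obtain A B where "complete_development M A" "complete_development N B"
      using IH [of M] IH [of N] by auto
    then have "complete_development (M \<bullet> N) (A \<bullet> B)"
      using no_redex by (fastforce simp: complete_development_def intro: par.App)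
    then show ?thesis ..
  qed
qed

text \<open>At most one contraction rule fits a given body. If the body is a regular value, its
  development \<open>A\<close> serves for the whole term, since a kept \<open>Try\<close> can still
  be contracted by \<open>regular_value_par\<close>.\<close>

lemma complete_development_Try:
  assumes M: "complete_development M A" and N: "complete_development N B"
  shows "\<exists>D. complete_development (Try M e N) D"
proof -
  note D = M [THEN complete_developmentD] N [THEN complete_developmentD]
  consider (raise) e' where "M = Raise e'" | (val) "regular_value M"
    | (no_redex) "\<not> regular_value M" "\<And>e'. M \<noteq> Raise e'" by blast
  then show ?thesis
  proof cases
    case raise
    have "complete_development (Try M e N) (if e = e' then B else Raise e')"
      unfolding raise
      by (rule complete_developmentI, erule par_TryE)
        (auto intro: par.try_catch par.try_pass D)
    then show ?thesis ..
  next
    case val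
    then have "complete_development (Try M e N) A"
      by (intro complete_developmentI, elim par_TryE)
        (auto intro: par.try_value regular_value_par D)
    then show ?thesis ..
  next
    case no_redex
    then have "complete_development (Try M e N) (Try A e B)"
      by (intro complete_developmentI, elim par_TryE) (auto intro: par.Try D)
    then show ?thesis ..
  qed
qed

lemma complete_development_exists: "\<exists>D. complete_development M D"
\<comment> \<open>Induction on size, because redexes such as those of \<open>rec_succ\<close> need
  developments of subterms below the immediate ones.\<close>
proof (induction M rule: measure_induct_rule [of size])
  case (less M)
  show ?case
  proof (cases M)
    case (Lam K)
    then obtain A where "complete_development K A" using less.IH [of K] by auto
    then have "complete_development M (Lam A)"
      unfolding Lam complete_development_def by (auto intro: par.Lam)
    then show ?thesis ..
  next
    case (App K L)
    then show ?thesis using less.IH complete_development_App by blast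
  next
    case (Try K e L)
    then show ?thesis
      using less.IH [of K] less.IH [of L] complete_development_Try by auto
  qed (auto simp: complete_development_def intro: par.intros)
qed

section \<open>Confluence\<close>

lemma red_imp_par: "M \<rightarrow>\<^sub>r N \<Longrightarrow> M \<Rightarrow>\<^sub>p N"
  by (induction rule: red.induct) (auto intro: par.intros)

lemma reds_Lam: "M \<rightarrow>\<^sub>r\<^sup>* M' \<Longrightarrow> Lam M \<rightarrow>\<^sub>r\<^sup>* Lam M'"
  by (induction rule: rtranclp_induct) (auto intro: rtranclp.rtrancl_into_rtrancl red.lam)

lemma reds_App:
  assumes "M \<rightarrow>\<^sub>r\<^sup>* M'" and "N \<rightarrow>\<^sub>r\<^sup>* N'"
  shows "M \<bullet> N \<rightarrow>\<^sub>r\<^sup>* M' \<bullet> N'"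
proof -
  have "M \<bullet> N \<rightarrow>\<^sub>r\<^sup>* M' \<bullet> N"
    using assms(1)
    by (induction rule: rtranclp_induct) (auto intro: rtranclp.rtrancl_into_rtrancl red.app_left)
  also have "M' \<bullet> N \<rightarrow>\<^sub>r\<^sup>* M' \<bullet> N'"
    using assms(2)
    by (induction rule: rtranclp_induct) (auto intro: rtranclp.rtrancl_into_rtrancl red.app_right)
  finally show ?thesis .
qed

lemma reds_Try:
  assumes "M \<rightarrow>\<^sub>r\<^sup>* M'" and "N \<rightarrow>\<^sub>r\<^sup>* N'"
  shows "Try M e N \<rightarrow>\<^sub>r\<^sup>* Try M' e N'"
proof -
  have "Try M e N \<rightarrow>\<^sub>r\<^sup>* Try M' e N"
    using assms(1)
    by (induction rule: rtranclp_induct) (auto intro: rtranclp.rtrancl_into_rtrancl red.try_body)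
  also have "Try M' e N \<rightarrow>\<^sub>r\<^sup>* Try M' e N'"
    using assms(2)
    by (induction rule: rtranclp_induct) (auto intro: rtranclp.rtrancl_into_rtrancl red.try_handler)
  finally show ?thesis .
qed

lemmas reds_step = converse_rtranclp_into_rtranclp [where r = red]

lemma par_imp_reds: "M \<Rightarrow>\<^sub>p N \<Longrightarrow> M \<rightarrow>\<^sub>r\<^sup>* N"
proof (induction rule: par.induct)
  case (beta M M' N N')
  \<comment> \<open>Reducing inside the redex before contracting it avoids having to prove that
    reduction is compatible with substitution.\<close>
  then show ?case
    by (intro rtranclp.rtrancl_into_rtrancl [where r = red, OF _ red.beta] reds_App reds_Lam)
next
  case (rec_succ X X' Y Y' N N')
  \<comment> \<open>Here contraction comes first: the copies are separate subterms of the
    contractum, so congruence suffices.\<close>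
  then show ?case
    by (intro reds_step [OF red.rec_succ] reds_App rtranclp.rtrancl_refl)
next
  case (fold_cons X X' Y Y' E E' L L')
  then show ?case
    by (intro reds_step [OF red.fold_cons] reds_App rtranclp.rtrancl_refl)
qed (rule reds_Lam reds_App reds_Try rtranclp.rtrancl_refl
    reds_step [OF red.raise_app]
    reds_step [OF red.try_catch]
    reds_step [OF red.try_pass]
    reds_step [OF red.try_value]
    reds_step [OF red.rec_zero]
    reds_step [OF red.rec_raise]
    reds_step [OF red.fold_nil]
    reds_step [OF red.fold_raise]; (assumption | rule rtranclp.rtrancl_refl))+

text \<open>Parallel reduction lies between reduction and its reflexive transitive closure, so the
  closures coincide.\<close>

lemma rtranclp_par_eq: "(\<Rightarrow>\<^sub>p)\<^sup>*\<^sup>* = (\<rightarrow>\<^sub>r\<^sup>*)"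
  by (rule rtranclp_subset) (auto intro: red_imp_par par_imp_reds)

theorem theorem3p6:
  fixes M N N' :: "'e::countable trm"
  assumes "M \<rightarrow>\<^sub>r\<^sup>* N" and "M \<rightarrow>\<^sub>r\<^sup>* N'"
  shows "\<exists>P. N \<rightarrow>\<^sub>r\<^sup>* P \<and> N' \<rightarrow>\<^sub>r\<^sup>* P"
proof -
  \<comment> \<open>The diamond property is a special case of strong confluence: the complete
    development of \<open>x\<close> closes both sides in one step.\<close>
  have "strong_confluentp ((\<Rightarrow>\<^sub>p) :: 'e trm \<Rightarrow> _)"
  proof (rule strong_confluentpI)
    fix x y z :: "'e trm"
    assume "x \<Rightarrow>\<^sub>p y" "x \<Rightarrow>\<^sub>p z"
    moreover obtain D where "complete_development x D"
      using complete_development_exists by blast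
    ultimately have "y \<Rightarrow>\<^sub>p D" "z \<Rightarrow>\<^sub>p D"
      by (auto dest: complete_developmentD)
    then show "\<exists>u. (\<Rightarrow>\<^sub>p)\<^sup>*\<^sup>* y u \<and> (\<Rightarrow>\<^sub>p)\<^sup>=\<^sup>= z u"
      by auto
  qed
  then have "confluentp ((\<Rightarrow>\<^sub>p) :: 'e trm \<Rightarrow> _)"
    by (rule strong_confluentp_imp_confluentp)
  then show ?thesis
    using assms confluentpD [of "(\<Rightarrow>\<^sub>p)" M N N'] unfolding rtranclp_par_eq by blast
qed

end
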